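(* Let $\Sigma$ be a finite alphabet, $(D,\leq,0,1)$ a linearly ordered set with smallest element $0$ and largest element $1$, $P=P[1..m]$ ($m\geq 1$) a fuzzy pattern over $\Sigma$, $X=X[1..n]$ a string over $\Sigma$, and $\mu\in D$ a threshold. Then the FL-Matching algorithm, run on $P$, $X$, $\mu$, finds all and only the $\mu$-occurrences of $P$ in $X$; that is, for every $i\in\{1,\ldots,n\}$, the algorithm prints $i$ if and only if $m\leq i\leq n$ and $X[i-m+1..i]\sim_\mu P[1..m]$.
   Context: A fuzzy symbol over $\Sigma$ is a fuzzy subset $\alpha$ of $\Sigma$, i.e. it is given by a membership function $\mu_\alpha:\Sigma\to D$. A fuzzy pattern $P[1..m]$, $m\ge 1$, is a finite non-empty sequence of fuzzy symbols. For $c\in\Sigma$ and a fuzzy symbol $\alpha$, write $c\sim_\mu\alpha$ if $\mu_\alpha(c)\geq\mu$. For a string $x[1..q]$ over $\Sigma$ and a sequence $Q[1..q]$ of fuzzy symbols, write $x\sim_\mu Q$ if $x[j]\sim_\mu Q[j]$ for all $1\leq j\leq q$ (so $\varepsilon$ matches the empty sequence, where $\varepsilon$ is the empty string). A $\mu$-occurrence of $P$ in $X$ is a segment $X[i-m+1..i]$, $m\leq i\leq n$, with $X[i-m+1..i]\sim_\mu P[1..m]$; it is identified by its end position $i$. The algorithm maintains a trajectory $\tau$, a non-empty list of strings over $\Sigma$ in order of decreasing length, whose last element is $\varepsilon$. The initial (empty) trajectory is $\tau_0=[\varepsilon]$. Let $head(\tau)$ be the first element of $\tau$, $tail(\tau)$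 the list of the remaining elements, $length(\tau)$ the number of strings in $\tau$, and $width(\tau)=|head(\tau)|$. Operations, with $x=head(\tau)$ and $c\in\Sigma$: - $isPromoted(\tau,c)$ (used when $|x|<m$ and $x\sim_\mu P[1..|x|]$): true iff $c\sim_\mu P[|x|+1]$ (equivalently $xc\sim_\mu P[1..|x|+1]$). - $promote(\tau,c)$ (used when additionally $isPromoted(\tau,c)$ is true): the list, in order of decreasing length, of the strings in $\{x'c \mid x'\in\tau,\ c\sim_\mu P[|x'|+1]\}\cup\{\varepsilon\}$. - $rollback(\tau)$ (used when $|x|>0$): $tail(\tau)$. FL-Matching algorithm: set $\tau:=\tau_0$. For $i=1$ to $n$ do: (1) while $length(\tau)>1$ and not $isPromoted(\tau,X[i])$, set $\tau:=rollback(\tau)$; (2) if $isPromoted(\tau,X[i])$, set $\tau:=promote(\tau,X[i])$; (3) if $width(\tau)=m$, print $i$ and set $\tau:=rollback(\tau)$. *)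

theory Defs
  imports Main "HOL-Library.While_Combinator"
begin

text \<open>
  A fuzzy symbol over the alphabet \<open>'a\<close> is its membership function. Strings, fuzzy patterns and
  trajectories are lists. Positions in the informal notation start at 1, list indices at 0: the
  pattern symbol at position \<open>|x| + 1\<close> is \<open>P ! length x\<close>.
\<close>

type_synonym ('a, 'd) fuzzy_symbol = "'a \<Rightarrow> 'd"
type_synonym ('a, 'd) fuzzy_pattern = "('a, 'd) fuzzy_symbol list"
type_synonym 'a trajectory = "'a list list"

definition sym_match :: "'d::linorder \<Rightarrow> 'a \<Rightarrow> ('a, 'd) fuzzy_symbol \<Rightarrow> bool" where
  "sym_match \<mu> c \<alpha> \<longleftrightarrow> \<alpha> c \<ge> \<mu>"

definition str_match :: "'d::linorder \<Rightarrow> 'a list \<Rightarrow> ('a, 'd) fuzzy_pattern \<Rightarrow> bool" where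
  "str_match \<mu> x Q \<longleftrightarrow> length x = length Q \<and> (\<forall>j < length Q. sym_match \<mu> (x ! j) (Q ! j))"

text \<open>The segment \<open>X[a..b]\<close>, with \<open>a \<ge> 1\<close> and both ends included.\<close>

definition segment :: "'a list \<Rightarrow> nat \<Rightarrow> nat \<Rightarrow> 'a list" where
  "segment X a b = map (\<lambda>k. X ! (k - 1)) [a..<b + 1]"

text \<open>An occurrence is identified by its end position \<open>i\<close>.\<close>

definition occurrence ::
  "'d::linorder \<Rightarrow> ('a, 'd) fuzzy_pattern \<Rightarrow> 'a list \<Rightarrow> nat \<Rightarrow> bool" where
  "occurrence \<mu> P X i \<longleftrightarrow>
     length P \<le> i \<and> i \<le> length X \<and> str_match \<mu> (segment X (i - length P + 1) i) P"

definition is_trajectory :: "'a trajectory \<Rightarrow> bool" where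
  "is_trajectory \<tau> \<longleftrightarrow>
     \<tau> \<noteq> [] \<and> sorted_wrt (\<lambda>u v. length u > length v) \<tau> \<and> last \<tau> = []"

definition init_traj :: "'a trajectory" where
  "init_traj = [[]]"

definition width :: "'a trajectory \<Rightarrow> nat" where
  "width \<tau> = length (hd \<tau>)"

text \<open>Only meaningful for \<open>width \<tau> < length P\<close>, as \<open>P ! length P\<close> is unspecified.\<close>

definition is_promoted ::
  "'d::linorder \<Rightarrow> ('a, 'd) fuzzy_pattern \<Rightarrow> 'a trajectory \<Rightarrow> 'a \<Rightarrow> bool" where
  "is_promoted \<mu> P \<tau> c \<longleftrightarrow> sym_match \<mu> c (P ! length (hd \<tau>))"

text \<open>
  On trajectories the description below determines the list uniquely; see \<open>promote_eq\<close>.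
\<close>

definition promote ::
  "'d::linorder \<Rightarrow> ('a, 'd) fuzzy_pattern \<Rightarrow> 'a trajectory \<Rightarrow> 'a \<Rightarrow> 'a trajectory" where
  "promote \<mu> P \<tau> c = (THE ys.
     sorted_wrt (\<lambda>u v. length u > length v) ys \<and>
     set ys = {x @ [c] | x. x \<in> set \<tau> \<and> sym_match \<mu> c (P ! length x)} \<union> {[]})"

definition rollback :: "'a trajectory \<Rightarrow> 'a trajectory" where
  "rollback \<tau> = tl \<tau>"

text \<open>
  Iteration \<open>i\<close> of the main loop, acting on the current trajectory and the list of the positions
  printed so far.
\<close>

definition fl_iteration ::
  "'d::linorder \<Rightarrow> ('a, 'd) fuzzy_pattern \<Rightarrow> 'a list \<Rightarrow> nat \<Rightarrow>
     'a trajectory \<times> nat list \<Rightarrow> 'a trajectory \<times> nat list" where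
  "fl_iteration \<mu> P X i = (\<lambda>(\<tau>, out).
     let c = X ! (i - 1);
         \<tau>1 = while (\<lambda>t. length t > 1 \<and> \<not> is_promoted \<mu> P t c) rollback \<tau>;
         \<tau>2 = (if is_promoted \<mu> P \<tau>1 c then promote \<mu> P \<tau>1 c else \<tau>1)
     in if width \<tau>2 = length P then (rollback \<tau>2, out @ [i]) else (\<tau>2, out))"

definition fl_matching ::
  "'d::linorder \<Rightarrow> ('a, 'd) fuzzy_pattern \<Rightarrow> 'a list \<Rightarrow> nat list" where
  "fl_matching \<mu> P X =
     snd (fold (fl_iteration \<mu> P X) [1..<length X + 1] (init_traj, []))"

lemma sorted_wrt_length_unique:
  assumes "sorted_wrt (\<lambda>u v. length u > length v) xs"
    and "sorted_wrt (\<lambda>u v. length u > length v) ys"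
    and "set xs = set ys"
  shows "xs = ys"
  using assms
proof (induction xs arbitrary: ys)
  case Nil
  then show ?case by simp
next
  case (Cons x xs)
  obtain y zs where ys: "ys = y # zs" using Cons.prems(3) by (cases ys) auto
  have "x \<in> insert y (set zs)" "y \<in> insert x (set xs)"
    using Cons.prems(3) ys by auto
  then have xy: "x = y"
    using Cons.prems(1,2) ys by (metis insert_iff not_less_iff_gr_or_eq sorted_wrt.simps(2))
  have "x \<notin> set xs" "x \<notin> set zs"
    using Cons.prems(1,2) ys xy by auto
  then have "set xs = set zs"
    using Cons.prems(3) ys xy by auto
  then show ?case
    using Cons.IH[of zs] Cons.prems(1,2) ys xy by simp
qed

lemma promote_eq:
  assumes "is_trajectory \<tau>"
  shows "promote \<mu> P \<tau> c =
    map (\<lambda>x. x @ [c]) (filter (\<lambda>x. sym_match \<mu> c (P ! length x)) \<tau>) @ [[]]"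
    (is "_ = ?ys")
proof -
  have sorted: "sorted_wrt (\<lambda>u v. length u > length v) ?ys"
    using assms
    by (auto simp: is_trajectory_def sorted_wrt_append sorted_wrt_map intro: sorted_wrt_filter)
  have set: "set ?ys = {x @ [c] | x. x \<in> set \<tau> \<and> sym_match \<mu> c (P ! length x)} \<union> {[]}"
    by auto
  show ?thesis
    unfolding promote_def
  proof (rule the_equality)
    show "sorted_wrt (\<lambda>u v. length u > length v) ?ys \<and>
      set ?ys = {x @ [c] | x. x \<in> set \<tau> \<and> sym_match \<mu> c (P ! length x)} \<union> {[]}"
      using sorted set by (rule conjI)
  next
    fix zs
    assume "sorted_wrt (\<lambda>u v. length u > length v) zs \<and>
      set zs = {x @ [c] | x. x \<in> set \<tau> \<and> sym_match \<mu> c (P ! length x)} \<union> {[]}"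
    then show "zs = ?ys"
      using set by (intro sorted_wrt_length_unique[OF _ sorted]) (simp_all only:)
  qed
qed

end

(* After i iterations the trajectory lists, longest first, exactly the suffixes s of X[1..i] of
   length below m that match P[1..|s|]. The rollbacks of step (1) only discard strings that cannot
   be extended by X[i], so steps (1) and (2) together extend every extensible string of the
   trajectory. The head then has length m precisely when an occurrence ends at i, and step (3)
   removes it again. *)
theory Submission
  imports Defs "HOL-Library.Sublist"
begin

text \<open>The bound \<open>k\<close> is strict and a parameter because two values matter:
  \<open>length P\<close> describes the trajectory between iterations, \<open>Suc (length P)\<close>
  the one just before step (3), where a full match may be present.\<close>

definition matching_suffixes ::
  "'d::linorder \<Rightarrow> ('a, 'd) fuzzy_pattern \<Rightarrow> nat \<Rightarrow> 'a list \<Rightarrow> 'a list set" where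
  "matching_suffixes \<mu> P k x =
     {s. suffix s x \<and> length s < k \<and> str_match \<mu> s (take (length s) P)}"

lemma str_match_Nil [simp]: "str_match \<mu> [] []"
  by (simp add: str_match_def)

lemma str_match_snoc:
  assumes "length s < length P"
  shows "str_match \<mu> (s @ [c]) (take (Suc (length s)) P) \<longleftrightarrow>
    str_match \<mu> s (take (length s) P) \<and> sym_match \<mu> c (P ! length s)"
  using assms by (auto simp: str_match_def nth_append less_Suc_eq)

text \<open>A nonempty suffix of \<open>x @ [c]\<close> is \<open>s @ [c]\<close> for a suffix
  \<open>s\<close> of \<open>x\<close>. Dropping \<open>c\<close> lowers the length bound by one,
  which also keeps \<open>P ! length s\<close> in range. The right-hand side has the shape of the
  set in \<open>promote\<close>.\<close>

lemma matching_suffixes_snoc: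
  "matching_suffixes \<mu> P (Suc (length P)) (x @ [c]) =
     {s @ [c] | s. s \<in> matching_suffixes \<mu> P (length P) x \<and> sym_match \<mu> c (P ! length s)} \<union> {[]}"
  by (auto simp: matching_suffixes_def suffix_snoc str_match_snoc)

lemma is_trajectory_suffix:
  assumes "is_trajectory \<tau>" "suffix t \<tau>" "t \<noteq> []"
  shows "is_trajectory t"
  using assms by (auto simp: is_trajectory_def suffix_def sorted_wrt_append)

lemma is_trajectory_extend:
  assumes "is_trajectory \<tau>"
  shows "is_trajectory (map (\<lambda>x. x @ [c]) (filter Q \<tau>) @ [[]])"
  using assms
  by (auto simp: is_trajectory_def sorted_wrt_append sorted_wrt_map intro: sorted_wrt_filter)

text \<open>Each discarded head fails \<open>Q\<close>, so the filtered list never changes: this is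
  why rollbacks lose nothing that promotion could use. The guard \<open>length t > 1\<close> keeps
  the list nonempty, and its length decreases.\<close>

lemma while_rollback:
  fixes Q :: "'a list \<Rightarrow> bool"
  assumes "\<tau> \<noteq> []"
  defines "t \<equiv> while (\<lambda>t. length t > 1 \<and> \<not> Q (hd t)) rollback \<tau>"
  shows "t \<noteq> []" and "suffix t \<tau>" and "filter Q t = filter Q \<tau>"
    and "length t > 1 \<Longrightarrow> Q (hd t)"
proof -
  let ?b = "\<lambda>t. length t > 1 \<and> \<not> Q (hd t)"
  let ?I = "\<lambda>t. t \<noteq> [] \<and> suffix t \<tau> \<and> filter Q t = filter Q \<tau>"
  have "?I t \<and> \<not> ?b t"
    unfolding t_def
  proof (rule while_rule[where P = ?I and r = "Wellfounded.measure length"])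
    show "?I (rollback s)" if "?I s" "?b s" for s
    proof (cases s)
      case (Cons y ys)
      with that show ?thesis
        by (auto simp: rollback_def suffix_ConsD)
    qed (use that in simp)
  qed (use assms in \<open>auto simp: rollback_def\<close>)
  then show "t \<noteq> []" "suffix t \<tau>" "filter Q t = filter Q \<tau>" "length t > 1 \<Longrightarrow> Q (hd t)"
    by auto
qed

text \<open>One closed form covers both outcomes of step (2), so later arguments need neither the
  loop nor a case split on promotion.\<close>

lemma rollback_promote:
  fixes P :: "('a, 'd::linorder) fuzzy_pattern" and \<mu> :: 'd and c :: 'a
  assumes \<tau>: "is_trajectory \<tau>"
  defines "t \<equiv> while (\<lambda>t. length t > 1 \<and> \<not> is_promoted \<mu> P t c) rollback \<tau>"
  shows "(if is_promoted \<mu> P t c then promote \<mu> P t c else t) =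
    map (\<lambda>x. x @ [c]) (filter (\<lambda>x. sym_match \<mu> c (P ! length x)) \<tau>) @ [[]]"
proof -
  let ?Q = "\<lambda>x. sym_match \<mu> c (P ! length x)"
  have ne: "\<tau> \<noteq> []"
    using \<tau> by (simp add: is_trajectory_def)
  note t = while_rollback[OF ne, of ?Q, folded is_promoted_def, folded t_def]
  have traj: "is_trajectory t"
    by (rule is_trajectory_suffix[OF \<tau> t(2,1)])
  show ?thesis
  proof (cases "is_promoted \<mu> P t c")
    case True
    then show ?thesis
      using promote_eq[OF traj, of \<mu> P c] t(3) by simp
  next
    \<comment> \<open>The loop can then only have stopped at a singleton, which is
      \<open>[[]]\<close>. Its filter is empty, hence so is that of \<tau>, and the closed form also
      collapses to \<open>[[]]\<close>.\<close>
    case False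
    then have "t = [hd t]"
      using t(1,4) by (cases t) auto
    then have "t = [[]]"
      using traj unfolding is_trajectory_def by (metis last.simps)
    then show ?thesis
      using False t(3)[symmetric] by (simp add: is_promoted_def)
  qed
qed

text \<open>The head is the longest string, so if any string attains the upper bound
  \<open>k\<close>, the head does.\<close>

lemma width_eq_iff:
  assumes \<tau>: "is_trajectory \<tau>" and le: "\<forall>s \<in> set \<tau>. length s \<le> k"
  shows "width \<tau> = k \<longleftrightarrow> (\<exists>s \<in> set \<tau>. length s = k)"
proof (cases \<tau>)
  case (Cons y ys)
  with assms show ?thesis
    by (fastforce simp: is_trajectory_def width_def)
qed (use \<tau> in \<open>simp add: is_trajectory_def\<close>)

text \<open>Lengths decrease strictly, so the head is the only string of its length and removing it
  amounts to a length restriction. Positive width means that the head is not the final empty string,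
  so the tail is nonempty.\<close>

lemma rollback_trajectory:
  assumes \<tau>: "is_trajectory \<tau>" and pos: "width \<tau> > 0"
  shows "is_trajectory (rollback \<tau>)"
    and "set (rollback \<tau>) = {s \<in> set \<tau>. length s < width \<tau>}"
proof -
  obtain y ys where "\<tau> = y # ys" "ys \<noteq> []"
    using assms by (cases \<tau>) (auto simp: is_trajectory_def width_def split: if_splits)
  with \<tau> show "is_trajectory (rollback \<tau>)" "set (rollback \<tau>) = {s \<in> set \<tau>. length s < width \<tau>}"
    by (auto simp: is_trajectory_def width_def rollback_def)
qed

lemma segment_eq_drop_take:
  assumes "k \<le> i" "i \<le> length X"
  shows "segment X (Suc (i - k)) i = drop (i - k) (take i X)"
  using assms by (intro nth_equalityI) (auto simp: segment_def simp del: upt_Suc)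

text \<open>A suffix of \<open>take i X\<close> is determined by its length; the one of length
  \<open>length P\<close> is the segment that an occurrence at \<open>i\<close> has to
  match.\<close>

lemma occurrence_iff_matching_suffixes:
  assumes "i \<le> length X"
  shows "occurrence \<mu> P X i \<longleftrightarrow>
    (\<exists>s \<in> matching_suffixes \<mu> P (Suc (length P)) (take i X). length s = length P)"
proof
  assume "occurrence \<mu> P X i"
  with assms show "\<exists>s \<in> matching_suffixes \<mu> P (Suc (length P)) (take i X). length s = length P"
    by (intro bexI[where x = "drop (i - length P) (take i X)"])
      (auto simp: occurrence_def segment_eq_drop_take matching_suffixes_def suffix_drop)
next
  assume "\<exists>s \<in> matching_suffixes \<mu> P (Suc (length P)) (take i X). length s = length P"
  then obtain s where s: "suffix s (take i X)" "length s = length P" "str_match \<mu> s P"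
    by (auto simp: matching_suffixes_def)
  have le: "length P \<le> i"
    using s(1,2) assms suffix_length_le by fastforce
  obtain zs where zs: "take i X = zs @ s"
    using s(1) by (auto simp: suffix_def)
  then have "length zs = i - length P"
    using s(2) assms by (auto dest: arg_cong[of _ _ length])
  with zs have "s = drop (i - length P) (take i X)"
    by simp
  with s(3) le assms show "occurrence \<mu> P X i"
    by (simp add: occurrence_def segment_eq_drop_take)
qed

lemma fl_iteration_correct:
  fixes P :: "('a, 'd::linorder) fuzzy_pattern"
  assumes P: "length P \<ge> 1" and i: "i < length X"
    and \<tau>: "is_trajectory \<tau>" "set \<tau> = matching_suffixes \<mu> P (length P) (take i X)"
  obtains \<tau>' where
    "fl_iteration \<mu> P X (Suc i) (\<tau>, out) =
       (\<tau>', if occurrence \<mu> P X (Suc i) then out @ [Suc i] else out)"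
    "is_trajectory \<tau>'" "set \<tau>' = matching_suffixes \<mu> P (length P) (take (Suc i) X)"
proof -
  let ?M = "\<lambda>k. matching_suffixes \<mu> P k (take (Suc i) X)"
  define c where "c = X ! i"
  \<comment> \<open>The trajectory after steps (1) and (2), in the closed form of
    \<open>rollback_promote\<close>.\<close>
  define \<rho> where "\<rho> = map (\<lambda>x. x @ [c]) (filter (\<lambda>x. sym_match \<mu> c (P ! length x)) \<tau>) @ [[]]"
  have \<rho>_traj: "is_trajectory \<rho>"
    unfolding \<rho>_def by (rule is_trajectory_extend[OF \<tau>(1)])
  have take_Suc: "take (Suc i) X = take i X @ [c]"
    using i by (simp add: c_def take_Suc_conv_app_nth)
  have \<rho>_set: "set \<rho> = ?M (Suc (length P))"
    unfolding take_Suc matching_suffixes_snoc \<rho>_def using \<tau>(2) by auto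
  have width: "width \<rho> = length P \<longleftrightarrow> occurrence \<mu> P X (Suc i)"
  proof -
    have "\<forall>s \<in> set \<rho>. length s \<le> length P"
      by (auto simp: \<rho>_set matching_suffixes_def)
    then show ?thesis
      using width_eq_iff[OF \<rho>_traj] occurrence_iff_matching_suffixes[of "Suc i" X \<mu> P] i \<rho>_set
      by simp
  qed
  \<comment> \<open>The simplifier turns the \<open>1\<close> of the loop guard into
    \<open>Suc 0\<close>, so \<open>rollback_promote\<close> has to be brought into that form before
    it can rewrite the loop.\<close>
  have iter: "fl_iteration \<mu> P X (Suc i) (\<tau>, out) =
      (if width \<rho> = length P then (rollback \<rho>, out @ [Suc i]) else (\<rho>, out))"
    by (simp add: fl_iteration_def Let_def rollback_promote[OF \<tau>(1), unfolded One_nat_def]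
      flip: c_def \<rho>_def)
  have restrict: "?M (length P) = {s \<in> ?M (Suc (length P)). length s < length P}"
    by (auto simp: matching_suffixes_def)
  show thesis
  proof (cases "width \<rho> = length P")
    case True
    with P have "width \<rho> > 0"
      by linarith
    with True have "is_trajectory (rollback \<rho>)" "set (rollback \<rho>) = ?M (length P)"
      using rollback_trajectory[OF \<rho>_traj] \<rho>_set restrict by simp_all
    with True iter width show thesis
      by (intro that[of "rollback \<rho>"]) auto
  next
    \<comment> \<open>No suffix of full length matches, so the bounds \<open>length P\<close> and
      \<open>Suc (length P)\<close> select the same strings and \<rho> already satisfies the
      invariant.\<close>
    case False
    with width have "\<forall>s \<in> ?M (Suc (length P)). length s \<noteq> length P"
      using occurrence_iff_matching_suffixes[of "Suc i" X \<mu> P] i by auto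
    then have "?M (length P) = ?M (Suc (length P))"
      by (auto simp: matching_suffixes_def less_Suc_eq)
    with False iter width \<rho>_traj \<rho>_set show thesis
      by (intro that[of \<rho>]) auto
  qed
qed

text \<open>Induction over the number of iterations, carrying the invariant on the trajectory
  together with the exact output list.\<close>

lemma fold_fl_iteration:
  fixes P :: "('a, 'd::linorder) fuzzy_pattern"
  assumes P: "length P \<ge> 1" and "n \<le> length X"
  shows "\<exists>\<tau>. fold (fl_iteration \<mu> P X) [1..<n + 1] (init_traj, []) =
      (\<tau>, filter (occurrence \<mu> P X) [1..<n + 1]) \<and>
    is_trajectory \<tau> \<and> set \<tau> = matching_suffixes \<mu> P (length P) (take n X)"
  using assms(2)
proof (induction n)
  case 0
  \<comment> \<open>Here \<open>length P \<ge> 1\<close> puts the empty string below the strict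
    bound.\<close>
  have "matching_suffixes \<mu> P (length P) [] = {[]}"
    using P by (auto simp: matching_suffixes_def)
  then show ?case
    by (simp add: init_traj_def is_trajectory_def)
next
  case (Suc n)
  then obtain \<tau> where \<tau>:
    "fold (fl_iteration \<mu> P X) [1..<n + 1] (init_traj, []) =
       (\<tau>, filter (occurrence \<mu> P X) [1..<n + 1])"
    "is_trajectory \<tau>" "set \<tau> = matching_suffixes \<mu> P (length P) (take n X)"
    by auto
  have "n < length X"
    using Suc.prems by simp
  from fl_iteration_correct[OF P this \<tau>(2,3)] obtain \<tau>' where
    "fl_iteration \<mu> P X (Suc n) (\<tau>, filter (occurrence \<mu> P X) [1..<n + 1]) =
       (\<tau>', if occurrence \<mu> P X (Suc n) then filter (occurrence \<mu> P X) [1..<n + 1] @ [Suc n]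
            else filter (occurrence \<mu> P X) [1..<n + 1])"
    "is_trajectory \<tau>'" "set \<tau>' = matching_suffixes \<mu> P (length P) (take (Suc n) X)"
    by blast
  with \<tau>(1) show ?case
    by (intro exI[of _ \<tau>']) simp
qed

theorem theorem3p5:
  fixes P :: "('a::finite, 'd::{linorder, order_bot, order_top}) fuzzy_pattern"
    and X :: "'a list"
    and \<mu> :: 'd
  assumes "length P \<ge> 1"
  shows "\<forall>i \<in> {1..length X}. i \<in> set (fl_matching \<mu> P X) \<longleftrightarrow> occurrence \<mu> P X i"
proof -
  have "fl_matching \<mu> P X = filter (occurrence \<mu> P X) [1..<length X + 1]"
    using fold_fl_iteration[OF assms order_refl, of \<mu> X] by (auto simp: fl_matching_def)
  then show ?thesis
    by (auto simp del: upt_Suc)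
qed

end
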